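(* Let $G$ be a structured bilinear SISO system given by $\mathcal{C},\mathcal{K},\mathcal{N},\mathcal{B}$, with subsystem transfer functions $G_k$, and let $\widehat G$, with subsystem transfer functions $\widehat G_k$, be the reduced-order bilinear SISO system constructed by projection with $W,V\in\mathbb{C}^{n\times r}$. Let $\sigma_1,\ldots,\sigma_k\in\mathbb{C}$ be interpolation points at which the matrix functions $\mathcal{C}(s)$, $\mathcal{K}(s)^{-1}$, $\mathcal{N}(s)$ and $\mathcal{B}(s)$ are analytic and $\widehat{\mathcal{K}}(s)$ is full-rank. Let \[ v_1=\mathcal{K}(\sigma_1)^{-1}\mathcal{B}(\sigma_1),\qquad v_j=\mathcal{K}(\sigma_j)^{-1}\mathcal{N}(\sigma_{j-1})v_{j-1},\quad 2\le j\le k, \] \[ w_1=\mathcal{K}(\sigma_k)^{-\mathsf H}\mathcal{C}(\sigma_k)^{\mathsf H},\qquad w_j=\mathcal{K}(\sigma_{k-j+1})^{-\mathsf H}\mathcal{N}(\sigma_{k-j+1})^{\mathsf H}w_{j-1},\quad 2\le j\le k, \] and let $V$ and $W$ be such that $\operatorname{span}(V)\supseteq\operatorname{span}([v_1,\ldots,v_k])$ and $\operatorname{span}(W)\supseteq\operatorname{span}([w_1,\ldots,w_k])$. Then \[ G_1(\sigma_1)=\widehat G_1(\sigma_1),\quad\ldots,\quad G_{k-1}(\sigma_1,\ldots,\sigma_{k-1})=\widehat G_{k-1}(\sigma_1,\ldots,\sigma_{k-1}), \] \[ G_1(\sigma_k)=\widehat G_1(\sigma_k),\quad\ldots,\quad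 G_{k-1}(\sigma_2,\ldots,\sigma_k)=\widehat G_{k-1}(\sigma_2,\ldots,\sigma_k), \] and additionally \[ G_k(\sigma_1,\ldots,\sigma_k)=\widehat G_k(\sigma_1,\ldots,\sigma_k),\qquad \nabla G_k(\sigma_1,\ldots,\sigma_k)=\nabla\widehat G_k(\sigma_1,\ldots,\sigma_k), \] \[ G_{q+\eta}(\sigma_1,\ldots,\sigma_q,\sigma_{k-\eta+1},\ldots,\sigma_k)=\widehat G_{q+\eta}(\sigma_1,\ldots,\sigma_q,\sigma_{k-\eta+1},\ldots,\sigma_k) \] hold for all $1\le q,\eta\le k$.
   Context: A structured bilinear SISO (single-input single-output) system $G$ is described by matrix-valued functions of a complex variable $\mathcal{C}\colon\mathbb{C}\to\mathbb{C}^{1\times n}$, $\mathcal{K}\colon\mathbb{C}\to\mathbb{C}^{n\times n}$, $\mathcal{N}\colon\mathbb{C}\to\mathbb{C}^{n\times n}$, $\mathcal{B}\colon\mathbb{C}\to\mathbb{C}^{n\times 1}$ (which may fail to be defined, or $\mathcal{K}$ may fail to be invertible, at some points), through its regular subsystem transfer functions \[ G_k(s_1,\ldots,s_k)=\mathcal{C}(s_k)\mathcal{K}(s_k)^{-1}\Big(\prod_{j=1}^{k-1}\mathcal{N}(s_{k-j})\mathcal{K}(s_{k-j})^{-1}\Big)\mathcal{B}(s_1),\qquad k\ge 1 . \] Products $\prod_{j=1}^{m}A_j$ of matrices are ordered $A_1A_2\cdots A_m$; empty products are identities. Given model reduction bases (truncation matrices) $W,V\in\mathbb{C}^{n\times r}$,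 the reduced-order system $\widehat G$ is given by \[ \widehat{\mathcal{C}}(s)=\mathcal{C}(s)V,\quad \widehat{\mathcal{K}}(s)=W^{\mathsf H}\mathcal{K}(s)V,\quad \widehat{\mathcal{B}}(s)=W^{\mathsf H}\mathcal{B}(s),\quad \widehat{\mathcal{N}}(s)=W^{\mathsf H}\mathcal{N}(s)V, \] and its transfer functions $\widehat G_k$ are defined by the same formula with hatted quantities. Here $^{\mathsf H}$ is the conjugate transpose, $^{-\mathsf H}$ the conjugate transpose of the inverse, and $\operatorname{span}$ of a matrix is its column space. For an analytic function $f$ of $s_1,\ldots,s_k$, $\nabla f=[\partial_{s_1}f\ \ldots\ \partial_{s_k}f]$ denotes the Jacobian, the concatenation of all first-order (complex) partial derivatives. *)

theory Defs
  imports "HOL-Complex_Analysis.Complex_Analysis"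
begin

text \<open>
  \<open>C(s)\<close> is a \<open>1 \<times> n\<close> and \<open>B(s)\<close> an \<open>n \<times> 1\<close> matrix. The matrix functions are total: at points where
  they are meant to be undefined, their values are arbitrary.
\<close>

record ('n::finite) bilinear_system =
  sysC :: "complex \<Rightarrow> complex^'n^1"
  sysK :: "complex \<Rightarrow> complex^'n^'n"
  sysN :: "complex \<Rightarrow> complex^'n^'n"
  sysB :: "complex \<Rightarrow> complex^1^'n"

definition ctranspose :: "complex^'m^'n \<Rightarrow> complex^'n^'m" where
  "ctranspose A = (\<chi> i j. cnj (A $ j $ i))"

text \<open>The ordered product \<open>A 1 ** A 2 ** \<dots> ** A m\<close>.\<close>

primrec matprod :: "(nat \<Rightarrow> complex^'n^'n) \<Rightarrow> nat \<Rightarrow> complex^'n^'n" where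
  "matprod A 0 = mat 1"
| "matprod A (Suc m) = matprod A m ** A (Suc m)"

text \<open>
  \<open>transfer G k s\<close> is \<open>G\<^sub>k(s 1, \<dots>, s k)\<close> for \<open>k \<ge> 1\<close>: the arguments are indexed from 1, and only
  the values of \<open>s\<close> on \<open>{1..k}\<close> matter. The resulting \<open>1 \<times> 1\<close> matrix is read as a scalar.
\<close>

definition transfer :: "('n::finite) bilinear_system \<Rightarrow> nat \<Rightarrow> (nat \<Rightarrow> complex) \<Rightarrow> complex" where
  "transfer G k s =
     (sysC G (s k) ** matrix_inv (sysK G (s k))
        ** matprod (\<lambda>j. sysN G (s (k - j)) ** matrix_inv (sysK G (s (k - j)))) (k - 1)
        ** sysB G (s 1)) $ 1 $ 1"

definition reduced_system ::
    "complex^'r^'n \<Rightarrow> complex^'r^'n \<Rightarrow> ('n::finite) bilinear_system \<Rightarrow> ('r::finite) bilinear_system" where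
  "reduced_system W V G =
     \<lparr> sysC = (\<lambda>s. sysC G s ** V),
       sysK = (\<lambda>s. ctranspose W ** sysK G s ** V),
       sysN = (\<lambda>s. ctranspose W ** sysN G s ** V),
       sysB = (\<lambda>s. ctranspose W ** sysB G s) \<rparr>"

definition mat_analytic_at :: "(complex \<Rightarrow> complex^'m^'n) \<Rightarrow> complex \<Rightarrow> bool" where
  "mat_analytic_at F z \<longleftrightarrow> (\<forall>i j. (\<lambda>s. F s $ i $ j) analytic_on {z})"

text \<open>
  \<open>matrix_inv\<close> is an arbitrary value on singular matrices, so analyticity of \<open>K(s)\<inverse>\<close> at a point
  has to include that the inverse exists on a neighbourhood of it.
\<close>

definition inverse_analytic_at :: "(complex \<Rightarrow> complex^'n^'n) \<Rightarrow> complex \<Rightarrow> bool" where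
  "inverse_analytic_at K z \<longleftrightarrow>
     (\<forall>\<^sub>F s in nhds z. invertible (K s)) \<and> mat_analytic_at (\<lambda>s. matrix_inv (K s)) z"

text \<open>
  Column spaces are complex subspaces, hence \<open>vec.span\<close>; the unqualified \<open>span\<close> is the real span.
\<close>

definition col_space :: "complex^'m^'n \<Rightarrow> (complex^'n) set" where
  "col_space A = vec.span (columns A)"

text \<open>
  First-order partial derivatives of a function of the \<open>k\<close> variables \<open>s 1, \<dots>, s k\<close>. Since \<open>deriv\<close>
  is total, their existence is a separate predicate.
\<close>

definition partials_exist :: "nat \<Rightarrow> ((nat \<Rightarrow> complex) \<Rightarrow> complex) \<Rightarrow> (nat \<Rightarrow> complex) \<Rightarrow> bool" where
  "partials_exist k f s \<longleftrightarrow>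
     (\<forall>i\<in>{1..k}. (\<lambda>z. f (s(i := z))) field_differentiable at (s i))"

definition complex_jacobian :: "nat \<Rightarrow> ((nat \<Rightarrow> complex) \<Rightarrow> complex) \<Rightarrow> (nat \<Rightarrow> complex) \<Rightarrow> complex list" where
  "complex_jacobian k f s = map (\<lambda>i. deriv (\<lambda>z. f (s(i := z))) (s i)) [1..<Suc k]"

end

theory Submission imports Defs begin

text \<open>
  Fix one argument slot and collect everything to the left and to the right of it: both transfer
  functions take the forms \<open>P(z) K(z)\<inverse> Q(z)\<close> and \<open>P(z) V (W\<^sup>H K(z) V)\<inverse> W\<^sup>H Q(z)\<close> with the same \<open>P\<close> and
  \<open>Q\<close>, because the span conditions let the reduced states be lifted back. Their difference is
  \<open>P E Q\<close> with \<open>E = K\<inverse> - V (W\<^sup>H K V)\<inverse> W\<^sup>H\<close>, and \<open>E = E K E\<close>. At the interpolation point both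
  \<open>P E\<close> and \<open>E Q\<close> vanish, so \<open>P E Q = (P E) K (E Q)\<close> vanishes to second order: values and
  partial derivatives agree.
\<close>

section \<open>Matrices\<close>

lemma matrix_mul_diff_right: "(A - B) ** C = A ** C - B ** C"
  for A B :: "'a::ring_1^'n^'m"
  by (simp add: vec_eq_iff matrix_matrix_mult_def left_diff_distrib sum_subtractf)

lemma matrix_mul_diff_left: "C ** (A - B) = C ** A - C ** B"
  for A B :: "'a::ring_1^'n^'m"
  by (simp add: vec_eq_iff matrix_matrix_mult_def right_diff_distrib sum_subtractf)

lemma matrix_mul_zero_left [simp]: "0 ** A = 0"
  for A :: "'a::semiring_1^'n^'m"
  by (simp add: vec_eq_iff matrix_matrix_mult_def)

lemma matrix_mul_zero_right [simp]: "A ** 0 = 0"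
  for A :: "'a::semiring_1^'n^'m"
  by (simp add: vec_eq_iff matrix_matrix_mult_def)

lemma matrix_inv_mult:
  assumes "invertible A"
  shows "A ** matrix_inv A = mat 1" "matrix_inv A ** A = mat 1"
proof -
  from assms have "\<exists>B. A ** B = mat 1 \<and> B ** A = mat 1"
    by (simp add: invertible_def)
  then have "A ** matrix_inv A = mat 1 \<and> matrix_inv A ** A = mat 1"
    unfolding matrix_inv_def by (rule someI_ex)
  then show "A ** matrix_inv A = mat 1" "matrix_inv A ** A = mat 1"
    by blast+
qed

lemma invertible_matrix_inv:
  assumes "invertible A"
  shows "invertible (matrix_inv A)"
  using matrix_inv_mult[OF assms] by (auto simp: invertible_def)

lemma matrix_inv_matrix_inv:
  fixes A :: "'a::semiring_1^'n^'m"
  assumes "invertible A"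
  shows "matrix_inv (matrix_inv A) = A"
proof -
  have "A = A ** (matrix_inv A ** matrix_inv (matrix_inv A))"
    using matrix_inv_mult(1)[OF invertible_matrix_inv[OF assms]] by simp
  also have "\<dots> = matrix_inv (matrix_inv A)"
    using matrix_inv_mult(1)[OF assms] by (simp add: matrix_mul_assoc)
  finally show ?thesis by simp
qed

text \<open>Full row rank makes the rows span the whole space, which yields a left inverse; for a
  square matrix it is two-sided.\<close>

lemma full_rank_invertible:
  fixes A :: "'a::field^'n^'n"
  assumes "rank A = CARD('n)"
  shows "invertible A"
proof -
  have "vec.dim (rows A) = vec.dimension TYPE('a) TYPE('n)"
    using assms by (simp add: row_rank_def_gen card_cart_basis vec.dimension_def)
  then show ?thesis
    by (simp add: vec.dim_eq_full invertible_left_inverse matrix_left_invertible_span_rows_gen)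
qed

lemma matrix_vector_mult_axis: "A *v axis k 1 = column k A"
  for A :: "'a::comm_semiring_1^'n^'m"
  by (simp add: matrix_mult_sum axis_def if_distrib[of "\<lambda>c. c *s _"] cong: if_cong)

text \<open>Column \<open>j\<close> of the inverse solves \<open>A *v x = axis j 1\<close>, so
  Cramer's rule gives its entries. As quotients of determinants they inherit analyticity from the
  entries of \<open>A\<close>.\<close>

lemma matrix_inv_cramer:
  fixes A :: "'a::field^'n^'n"
  assumes "invertible A"
  shows "matrix_inv A $ i $ j = det (\<chi> a b. if b = i then axis j 1 $ a else A $ a $ b) / det A"
proof -
  have "A *v (matrix_inv A *v axis j 1) = axis j 1"
    using matrix_inv_mult(1)[OF assms] by (simp add: matrix_vector_mul_assoc)
  moreover have "det A \<noteq> 0"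
    using assms by (simp add: invertible_det_nz)
  ultimately have "matrix_inv A *v axis j 1 =
      (\<chi> k. det (\<chi> a b. if b = k then axis j 1 $ a else A $ a $ b) / det A)"
    by (simp add: cramer)
  then have "(matrix_inv A *v axis j 1) $ i =
      det (\<chi> a b. if b = i then axis j 1 $ a else A $ a $ b) / det A"
    by simp
  then show ?thesis
    by (simp add: matrix_vector_mult_axis column_def)
qed

lemma ctranspose_mult: "ctranspose (A ** B) = ctranspose B ** ctranspose A"
  by (simp add: ctranspose_def matrix_matrix_mult_def vec_eq_iff mult.commute)

lemma ctranspose_ctranspose [simp]: "ctranspose (ctranspose A) = A"
  by (simp add: ctranspose_def vec_eq_iff)

text \<open>The columns of \<open>A\<close> are the images of the unit vectors, so every element of
  their span is \<open>A *v x\<close> for some \<open>x\<close>. These coefficient vectors become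
  the columns of \<open>Z\<close>, which turns a span condition into a factorization.\<close>

lemma columns_subset_col_space:
  fixes A :: "complex^'m^'n" and X :: "complex^'l^'n"
  assumes "columns X \<subseteq> col_space A"
  obtains Z where "X = A ** Z"
proof -
  have "\<exists>x. c = A *v x" if "c \<in> col_space A" for c
  proof -
    have "c \<in> vec.span ((*v) A ` range (\<lambda>i. axis i 1))"
      using that by (simp add: col_space_def columns_def matrix_vector_mult_axis image_image full_SetCompr_eq)
    also have "\<dots> = (*v) A ` vec.span (range (\<lambda>i. axis i 1))"
      by (simp add: vec.span_image)
    finally show ?thesis by blast
  qed
  then have "\<exists>x. column l X = A *v x" for l
    using assms by (auto simp: columns_def)
  then obtain x where x: "\<And>l. column l X = A *v x l" by metis
  have "X = A ** (\<chi> i l. x l $ i)"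
    using x by (simp add: vec_eq_iff column_def matrix_vector_mult_def matrix_matrix_mult_def)
  then show thesis by (rule that)
qed

section \<open>Analytic matrix functions\<close>

lemma mat_analytic_at_const [simp]: "mat_analytic_at (\<lambda>_. A) z"
  by (simp add: mat_analytic_at_def)

lemma mat_analytic_at_mult:
  assumes "mat_analytic_at F z" "mat_analytic_at H z"
  shows "mat_analytic_at (\<lambda>s. F s ** H s) z"
  using assms unfolding mat_analytic_at_def matrix_matrix_mult_def
  by (auto intro!: analytic_intros)

lemma mat_analytic_at_diff:
  assumes "mat_analytic_at F z" "mat_analytic_at H z"
  shows "mat_analytic_at (\<lambda>s. F s - H s) z"
  using assms unfolding mat_analytic_at_def by (auto intro!: analytic_intros)

lemma det_analytic_at:
  assumes "mat_analytic_at F z"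
  shows "(\<lambda>s. det (F s)) analytic_on {z}"
  using assms unfolding mat_analytic_at_def det_def by (auto intro!: analytic_intros)

lemma eventually_nhds_of_at:
  assumes "eventually P (at z)" "P z"
  shows "eventually P (nhds z)"
  using assms by (auto simp: eventually_at_filter elim!: eventually_mono)

lemma mat_analytic_at_cong:
  assumes "\<forall>\<^sub>F s in nhds z. F s = H s"
  shows "mat_analytic_at F z \<longleftrightarrow> mat_analytic_at H z"
  unfolding mat_analytic_at_def
  by (intro iff_allI analytic_at_cong refl) (auto intro: eventually_mono[OF assms])

text \<open>The determinant is continuous and nonzero at \<open>z\<close>, hence nonzero nearby,
  where Cramer's rule writes the inverse as a quotient of analytic functions.\<close>

lemma inverse_analytic_at_invertible:
  fixes F :: "complex \<Rightarrow> complex^'n^'n"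
  assumes F: "mat_analytic_at F z" and inv: "invertible (F z)"
  shows "inverse_analytic_at F z"
proof -
  have d0: "det (F z) \<noteq> 0"
    using inv by (simp add: invertible_det_nz)
  have "isCont (\<lambda>s. det (F s)) z"
    by (rule analytic_at_imp_isCont[OF det_analytic_at[OF F]])
  with d0 have "\<forall>\<^sub>F s in at z. det (F s) \<noteq> 0"
    by (auto simp: isCont_def dest: tendsto_imp_eventually_ne)
  from eventually_nhds_of_at[OF this d0]
  have ev: "\<forall>\<^sub>F s in nhds z. invertible (F s)"
    by (simp add: invertible_det_nz)
  have "(\<lambda>s. det (\<chi> a b. if b = i then axis j 1 $ a else F s $ a $ b) / det (F s)) analytic_on {z}"
    for i j
  proof (intro analytic_on_divide det_analytic_at F)
    show "mat_analytic_at (\<lambda>s. \<chi> a b. if b = i then axis j 1 $ a else F s $ a $ b) z"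
      unfolding mat_analytic_at_def
    proof (intro allI)
      fix a b
      show "(\<lambda>s. (\<chi> a b. if b = i then axis j 1 $ a else F s $ a $ b) $ a $ b) analytic_on {z}"
        using F by (cases "b = i") (simp_all add: mat_analytic_at_def)
    qed
  qed (use d0 in auto)
  \<comment> \<open>Cramer's formula is available only near \<open>z\<close>, which suffices because
    analyticity at a point depends on nearby values alone.\<close>
  moreover have "(\<lambda>s. matrix_inv (F s) $ i $ j) analytic_on {z} \<longleftrightarrow>
    (\<lambda>s. det (\<chi> a b. if b = i then axis j 1 $ a else F s $ a $ b) / det (F s)) analytic_on {z}" for i j
    by (intro analytic_at_cong refl eventually_mono[OF ev] matrix_inv_cramer)
  ultimately have "mat_analytic_at (\<lambda>s. matrix_inv (F s)) z"
    by (simp add: mat_analytic_at_def)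
  with ev show ?thesis
    by (simp add: inverse_analytic_at_def)
qed

lemma inverse_analytic_at_imp_invertible:
  assumes "inverse_analytic_at K z"
  shows "invertible (K z)"
  using assms by (auto simp: inverse_analytic_at_def dest: eventually_nhds_x_imp_x)

text \<open>Near \<open>z\<close>, \<open>K\<close> is itself the inverse of an analytic function
  that is invertible at \<open>z\<close>.\<close>

lemma inverse_analytic_at_imp_analytic:
  assumes "inverse_analytic_at K z"
  shows "mat_analytic_at K z"
proof -
  have ev: "\<forall>\<^sub>F s in nhds z. invertible (K s)" and an: "mat_analytic_at (\<lambda>s. matrix_inv (K s)) z"
    using assms by (auto simp: inverse_analytic_at_def)
  have "invertible (matrix_inv (K z))"
    by (intro invertible_matrix_inv inverse_analytic_at_imp_invertible assms)
  then have "mat_analytic_at (\<lambda>s. matrix_inv (matrix_inv (K s))) z"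
    using inverse_analytic_at_invertible[OF an] by (simp add: inverse_analytic_at_def)
  moreover have "\<forall>\<^sub>F s in nhds z. matrix_inv (matrix_inv (K s)) = K s"
    using ev by (rule eventually_mono) (rule matrix_inv_matrix_inv)
  ultimately show ?thesis
    by (simp add: mat_analytic_at_cong)
qed

text \<open>Each summand of the outer matrix product has two factors vanishing at \<open>z\<close>,
  so both terms of the product rule vanish.\<close>

lemma deriv_double_zero:
  fixes L :: "complex \<Rightarrow> complex^'n^'m" and R :: "complex \<Rightarrow> complex^'l^'p"
  assumes L: "mat_analytic_at L z" and M: "mat_analytic_at M z" and R: "mat_analytic_at R z"
    and zero: "L z = 0" "R z = 0"
  shows "((\<lambda>s. (L s ** M s ** R s) $ i $ j) has_field_derivative 0) (at z)"
proof -
  have M': "mat_analytic_at (\<lambda>s. L s ** M s) z"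
    by (rule mat_analytic_at_mult[OF L M])
  have "((\<lambda>s. (L s ** M s) $ i $ a * R s $ a $ j) has_field_derivative 0) (at z)" for a
  proof -
    have LM: "((\<lambda>s. (L s ** M s) $ i $ a) has_field_derivative deriv (\<lambda>s. (L s ** M s) $ i $ a) z) (at z)"
      using M' by (simp add: mat_analytic_at_def analytic_on_imp_differentiable_at[OF _ singletonI]
          DERIV_deriv_iff_field_differentiable)
    have RD: "((\<lambda>s. R s $ a $ j) has_field_derivative deriv (\<lambda>s. R s $ a $ j) z) (at z)"
      using R by (simp add: mat_analytic_at_def analytic_on_imp_differentiable_at[OF _ singletonI]
          DERIV_deriv_iff_field_differentiable)
    show ?thesis
      using DERIV_mult[OF LM RD] zero by simp
  qed
  then have "((\<lambda>s. \<Sum>a\<in>UNIV. (L s ** M s) $ i $ a * R s $ a $ j) has_field_derivative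
      (\<Sum>a\<in>(UNIV::'p set). 0)) (at z)"
    by (intro DERIV_sum)
  then show ?thesis
    by (simp add: matrix_matrix_mult_def)
qed

section \<open>The oblique projection error of the resolvent\<close>

text \<open>\<open>U\<close> stands for the conjugate transpose of \<open>W\<close>. If
  \<open>K\<close> and \<open>U ** K ** V\<close> are invertible,
  \<open>V ** matrix_inv (U ** K ** V) ** U ** K\<close> is the oblique projector onto the column
  space of \<open>V\<close> along the kernel of \<open>U ** K\<close>, and
  \<open>resolvent_error U V K ** K\<close> is the complementary projector.\<close>

definition resolvent_error ::
    "complex^'n^'r \<Rightarrow> complex^'r^'n \<Rightarrow> complex^'n^'n \<Rightarrow> complex^('n::finite)^'n" where
  "resolvent_error U V K = matrix_inv K - V ** matrix_inv (U ** K ** V) ** U"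

lemma resolvent_error_mult_left:
  assumes "invertible K" "invertible (U ** K ** V)"
  shows "U ** K ** resolvent_error U V K = 0"
proof -
  have "U ** K ** resolvent_error U V K =
      U ** (K ** matrix_inv K) - (U ** K ** V) ** matrix_inv (U ** K ** V) ** U"
    by (simp add: resolvent_error_def matrix_mul_diff_left matrix_mul_assoc)
  then show ?thesis
    by (simp add: matrix_inv_mult assms)
qed

lemma resolvent_error_mult_right:
  assumes "invertible K" "invertible (U ** K ** V)"
  shows "resolvent_error U V K ** K ** V = 0"
proof -
  have "resolvent_error U V K ** K ** V =
      (matrix_inv K ** K) ** V - V ** (matrix_inv (U ** K ** V) ** (U ** K ** V))"
    by (simp add: resolvent_error_def matrix_mul_diff_right matrix_mul_assoc)
  then show ?thesis
    by (simp add: matrix_inv_mult assms)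
qed

lemma resolvent_error_idem:
  assumes "invertible K" "invertible (U ** K ** V)"
  shows "resolvent_error U V K ** K ** resolvent_error U V K = resolvent_error U V K"
proof -
  have "resolvent_error U V K ** K ** resolvent_error U V K =
      (matrix_inv K ** K) ** resolvent_error U V K
        - V ** matrix_inv (U ** K ** V) ** (U ** K ** resolvent_error U V K)"
    \<comment> \<open>Only the leftmost error is unfolded; the other one must stay intact to be
      killed by \<open>U ** K\<close>.\<close>
    by (subst (1) resolvent_error_def) (simp add: matrix_mul_diff_right matrix_mul_assoc)
  then show ?thesis
    by (simp add: matrix_inv_mult resolvent_error_mult_left assms)
qed

text \<open>The assumption gives \<open>Q = K ** V ** c\<close>, and the error vanishes on
  \<open>K ** V\<close>.\<close>

lemma resolvent_error_annihilates_right: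
  assumes inv: "invertible K" "invertible (U ** K ** V)" and Q: "matrix_inv K ** Q = V ** c"
  shows "resolvent_error U V K ** Q = 0"
proof -
  have "Q = K ** (matrix_inv K ** Q)"
    by (simp add: matrix_mul_assoc matrix_inv_mult inv)
  then have "Q = K ** V ** c"
    by (simp add: Q matrix_mul_assoc)
  then have "resolvent_error U V K ** Q = (resolvent_error U V K ** K ** V) ** c"
    by (simp add: matrix_mul_assoc)
  then show ?thesis
    by (simp add: resolvent_error_mult_right inv)
qed

text \<open>Dually, \<open>P = c ** U ** K\<close>, and \<open>U ** K\<close> annihilates the
  error.\<close>

lemma resolvent_error_annihilates_left:
  assumes inv: "invertible K" "invertible (U ** K ** V)" and P: "P ** matrix_inv K = c ** U"
  shows "P ** resolvent_error U V K = 0"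
proof -
  have "P = (P ** matrix_inv K) ** K"
    by (simp add: matrix_inv_mult inv flip: matrix_mul_assoc)
  then have "P = c ** U ** K"
    by (simp add: P)
  then have "P ** resolvent_error U V K = c ** (U ** K ** resolvent_error U V K)"
    by (simp add: matrix_mul_assoc)
  then show ?thesis
    by (simp add: resolvent_error_mult_left inv)
qed

section \<open>Splitting a transfer function at an argument\<close>

text \<open>
  \<open>rgt G s j z\<close> is the part of the product to the right of \<open>K(z)\<inverse>\<close> when \<open>z\<close> is argument number
  \<open>j + 1\<close> and \<open>s 1, \<dots>, s j\<close> are the ones before it. In \<open>lft G t j z\<close> the arguments after \<open>z\<close> are
  listed from the last one down, as \<open>t 1, \<dots>, t j\<close>.
\<close>

primrec rgt :: "('n::finite) bilinear_system \<Rightarrow> (nat \<Rightarrow> complex) \<Rightarrow> nat \<Rightarrow> complex \<Rightarrow> complex^1^'n" where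
  "rgt G s 0 z = sysB G z"
| "rgt G s (Suc j) z =
     sysN G (s (Suc j)) ** (matrix_inv (sysK G (s (Suc j))) ** rgt G s j (s (Suc j)))"

primrec lft :: "('n::finite) bilinear_system \<Rightarrow> (nat \<Rightarrow> complex) \<Rightarrow> nat \<Rightarrow> complex \<Rightarrow> complex^'n^1" where
  "lft G t 0 z = sysC G z"
| "lft G t (Suc j) z = lft G t j (t (Suc j)) ** matrix_inv (sysK G (t (Suc j))) ** sysN G z"

lemma rgt_cong:
  assumes "\<And>l. 1 \<le> l \<Longrightarrow> l \<le> j \<Longrightarrow> s l = s' l"
  shows "rgt G s j z = rgt G s' j z"
  using assms by (induction j arbitrary: z) auto

lemma lft_cong:
  assumes "\<And>l. 1 \<le> l \<Longrightarrow> l \<le> j \<Longrightarrow> t l = t' l"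
  shows "lft G t j z = lft G t' j z"
  using assms by (induction j arbitrary: z) auto

lemma lft_matprod:
  "lft G t j (t (Suc j)) ** matrix_inv (sysK G (t (Suc j))) =
   sysC G (t 1) ** matrix_inv (sysK G (t 1))
     ** matprod (\<lambda>l. sysN G (t (Suc l)) ** matrix_inv (sysK G (t (Suc l)))) j"
  by (induction j) (simp_all add: matrix_mul_assoc)

text \<open>Induction on \<open>i\<close> moves the cut one argument up: by associativity, the last
  factor of \<open>lft\<close> at \<open>Suc j\<close> becomes the first factor of
  \<open>rgt\<close> at \<open>Suc i\<close>. With \<open>i + j + 1\<close> arguments in all,
  \<open>s (i + j + 2 - l)\<close> lists them from the last one down.\<close>

lemma transfer_split:
  "transfer G (Suc (i + j)) s =
   (lft G (\<lambda>l. s (i + j + 2 - l)) j (s (Suc i)) ** matrix_inv (sysK G (s (Suc i)))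
      ** rgt G s i (s (Suc i))) $ 1 $ 1"
proof (induction i arbitrary: j)
  case 0
  show ?case
    using lft_matprod[of G "\<lambda>l. s (j + 2 - l)" j] by (simp add: transfer_def)
next
  case (Suc i)
  show ?case
    using Suc.IH[of "Suc j"] by (simp add: matrix_mul_assoc)
qed

section \<open>The reduced system\<close>

locale projection =
  fixes G :: "('n::finite) bilinear_system"
    and W V :: "complex^('r::finite)^'n"
begin

abbreviation "Gred \<equiv> reduced_system W V G"
abbreviation "U \<equiv> ctranspose W"
abbreviation "E z \<equiv> resolvent_error U V (sysK G z)"

definition regular_at :: "complex \<Rightarrow> bool" where
  "regular_at z \<longleftrightarrow> invertible (sysK G z) \<and> invertible (U ** sysK G z ** V)"

text \<open>The factorization puts the full-order state in the column space of \<open>V\<close>.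
  Regularity is included so that annihilation by \<open>E\<close> follows from this predicate
  alone.\<close>

definition right_lift :: "(nat \<Rightarrow> complex) \<Rightarrow> nat \<Rightarrow> bool" where
  "right_lift s i \<longleftrightarrow> regular_at (s (Suc i)) \<and>
     (\<exists>c. matrix_inv (sysK G (s (Suc i))) ** rgt G s i (s (Suc i)) = V ** c)"

text \<open>The dual condition on row vectors: a factorization through \<open>U\<close> puts the
  conjugate transpose in the column space of \<open>W\<close>.\<close>

definition left_lift :: "(nat \<Rightarrow> complex) \<Rightarrow> nat \<Rightarrow> bool" where
  "left_lift t j \<longleftrightarrow> regular_at (t (Suc j)) \<and>
     (\<exists>c. lft G t j (t (Suc j)) ** matrix_inv (sysK G (t (Suc j))) = c ** U)"

lemma right_lift_annihilated:
  assumes "right_lift s i"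
  shows "E (s (Suc i)) ** rgt G s i (s (Suc i)) = 0"
  using assms by (auto simp: right_lift_def regular_at_def intro: resolvent_error_annihilates_right)

lemma left_lift_annihilated:
  assumes "left_lift t j"
  shows "lft G t j (t (Suc j)) ** E (t (Suc j)) = 0"
  using assms by (auto simp: left_lift_def regular_at_def intro: resolvent_error_annihilates_left)

text \<open>At each lifted argument \<open>E\<close> annihilates the right part, so the lifted
  reduced resolvent acts on it as the full one. No condition falls on the outermost argument
  \<open>z\<close>, which may vary freely.\<close>

lemma rgt_reduced:
  assumes "\<And>l. l < i \<Longrightarrow> right_lift s l"
  shows "rgt Gred s i z = U ** rgt G s i z"
  using assms
proof (induction i arbitrary: z)
  case 0
  show ?case by (simp add: reduced_system_def)
next
  case (Suc i)
  let ?z = "s (Suc i)"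
  have "E ?z ** rgt G s i ?z = 0"
    by (intro right_lift_annihilated Suc.prems) simp
  then have "V ** matrix_inv (U ** sysK G ?z ** V) ** U ** rgt G s i ?z = matrix_inv (sysK G ?z) ** rgt G s i ?z"
    by (simp add: resolvent_error_def matrix_mul_diff_right)
  moreover have "rgt Gred s i ?z = U ** rgt G s i ?z"
    using Suc by simp
  ultimately show ?case
    by (simp add: reduced_system_def flip: matrix_mul_assoc)
qed

lemma lft_reduced:
  assumes "\<And>l. l < j \<Longrightarrow> left_lift t l"
  shows "lft Gred t j z = lft G t j z ** V"
  using assms
proof (induction j arbitrary: z)
  case 0
  show ?case by (simp add: reduced_system_def)
next
  case (Suc j)
  let ?z = "t (Suc j)"
  have "lft G t j ?z ** E ?z = 0"
    by (intro left_lift_annihilated Suc.prems) simp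
  then have "lft G t j ?z ** V ** matrix_inv (U ** sysK G ?z ** V) ** U = lft G t j ?z ** matrix_inv (sysK G ?z)"
    by (simp add: resolvent_error_def matrix_mul_diff_left matrix_mul_assoc)
  moreover have "lft Gred t j ?z = lft G t j ?z ** V"
    using Suc by simp
  ultimately show ?case
    by (simp add: reduced_system_def matrix_mul_assoc)
qed

text \<open>All arguments but the cut one are lifted. The formula holds for any value of
  \<open>s (Suc i)\<close>, even where the reduced matrix is singular, because the same
  \<open>matrix_inv\<close> value appears on both sides.\<close>

lemma transfer_reduced:
  assumes s: "\<And>l. l < i \<Longrightarrow> right_lift s l"
    and t: "\<And>l. l < j \<Longrightarrow> left_lift (\<lambda>l. s (i + j + 2 - l)) l"
  shows "transfer Gred (Suc (i + j)) s =
    (lft G (\<lambda>l. s (i + j + 2 - l)) j (s (Suc i)) ** (V ** matrix_inv (U ** sysK G (s (Suc i)) ** V) ** U)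
      ** rgt G s i (s (Suc i))) $ 1 $ 1"
proof -
  have "rgt Gred s i (s (Suc i)) = U ** rgt G s i (s (Suc i))"
    by (rule rgt_reduced) (rule s)
  moreover have "lft Gred (\<lambda>l. s (i + j + 2 - l)) j (s (Suc i)) =
      lft G (\<lambda>l. s (i + j + 2 - l)) j (s (Suc i)) ** V"
    by (rule lft_reduced) (rule t)
  moreover have "sysK Gred z = U ** sysK G z ** V" for z
    by (simp add: reduced_system_def)
  ultimately show ?thesis
    by (simp only: transfer_split matrix_mul_assoc)
qed

lemma transfer_diff:
  assumes s: "\<And>l. l < i \<Longrightarrow> right_lift s l"
    and t: "\<And>l. l < j \<Longrightarrow> left_lift (\<lambda>l. s (i + j + 2 - l)) l"
  shows "transfer G (Suc (i + j)) s - transfer Gred (Suc (i + j)) s =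
    (lft G (\<lambda>l. s (i + j + 2 - l)) j (s (Suc i)) ** E (s (Suc i)) ** rgt G s i (s (Suc i))) $ 1 $ 1"
proof -
  have reduced: "transfer Gred (Suc (i + j)) s =
    (lft G (\<lambda>l. s (i + j + 2 - l)) j (s (Suc i)) ** (V ** matrix_inv (U ** sysK G (s (Suc i)) ** V) ** U)
      ** rgt G s i (s (Suc i))) $ 1 $ 1"
    by (rule transfer_reduced) (use s t in auto)
  have "transfer G (Suc (i + j)) s - transfer Gred (Suc (i + j)) s =
     (lft G (\<lambda>l. s (i + j + 2 - l)) j (s (Suc i)) ** matrix_inv (sysK G (s (Suc i)))
        ** rgt G s i (s (Suc i))
      - lft G (\<lambda>l. s (i + j + 2 - l)) j (s (Suc i))
        ** (V ** matrix_inv (U ** sysK G (s (Suc i)) ** V) ** U) ** rgt G s i (s (Suc i))) $ 1 $ 1"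
    \<comment> \<open>The reduced transfer function is replaced first, since
      \<open>transfer_split\<close> would split it too.\<close>
    by (simp only: reduced) (simp only: transfer_split vector_minus_component)
  then show ?thesis
    by (simp only: resolvent_error_def matrix_mul_diff_left matrix_mul_diff_right)
qed

text \<open>At the cut, annihilation from the right alone suffices, so left lifts are required only
  for the arguments after it.\<close>

lemma transfer_eq_right:
  assumes "\<And>l. l \<le> i \<Longrightarrow> right_lift s l"
    and "\<And>l. l < j \<Longrightarrow> left_lift (\<lambda>l. s (i + j + 2 - l)) l"
  shows "transfer G (Suc (i + j)) s = transfer Gred (Suc (i + j)) s"
proof -
  have "E (s (Suc i)) ** rgt G s i (s (Suc i)) = 0"
    by (intro right_lift_annihilated assms) simp
  then have "transfer G (Suc (i + j)) s - transfer Gred (Suc (i + j)) s = 0"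
    by (subst transfer_diff) (use assms in \<open>auto simp flip: matrix_mul_assoc\<close>)
  then show ?thesis by simp
qed

text \<open>With the cut at the first argument, \<open>E\<close> is annihilated from the
  left.\<close>

lemma transfer_eq_left:
  assumes "\<And>l. l \<le> j \<Longrightarrow> left_lift (\<lambda>l. s (j + 2 - l)) l"
  shows "transfer G (Suc j) s = transfer Gred (Suc j) s"
proof -
  have "lft G (\<lambda>l. s (j + 2 - l)) j (s 1) ** E (s 1) = 0"
    using left_lift_annihilated[OF assms[of j]] by simp
  then have "transfer G (Suc (0 + j)) s - transfer Gred (Suc (0 + j)) s = 0"
    by (subst transfer_diff) (use assms in auto)
  then show ?thesis by simp
qed

lemma right_lift_cong:
  assumes "\<And>l. 1 \<le> l \<Longrightarrow> l \<le> Suc i \<Longrightarrow> s l = s' l"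
  shows "right_lift s i \<longleftrightarrow> right_lift s' i"
proof -
  have "s (Suc i) = s' (Suc i)" "rgt G s i z = rgt G s' i z" for z
    using assms by (auto intro: rgt_cong)
  then show ?thesis by (simp add: right_lift_def)
qed

lemma left_lift_cong:
  assumes "\<And>l. 1 \<le> l \<Longrightarrow> l \<le> Suc j \<Longrightarrow> t l = t' l"
  shows "left_lift t j \<longleftrightarrow> left_lift t' j"
proof -
  have "t (Suc j) = t' (Suc j)" "lft G t j z = lft G t' j z" for z
    using assms by (auto intro: lft_cong)
  then show ?thesis by (simp add: left_lift_def)
qed

lemma partial_transfer:
  fixes i j :: nat and s :: "nat \<Rightarrow> complex"
  defines "t \<equiv> \<lambda>l. s (i + j + 2 - l)"
  assumes s: "\<And>l. l \<le> i \<Longrightarrow> right_lift s l"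
    and t: "\<And>l. l \<le> j \<Longrightarrow> left_lift t l"
    and C: "mat_analytic_at (sysC G) (s (Suc i))"
    and N: "mat_analytic_at (sysN G) (s (Suc i))"
    and B: "mat_analytic_at (sysB G) (s (Suc i))"
    and K: "inverse_analytic_at (sysK G) (s (Suc i))"
  shows "(\<lambda>z. transfer G (Suc (i + j)) (s(Suc i := z))) field_differentiable at (s (Suc i))"
    and "(\<lambda>z. transfer Gred (Suc (i + j)) (s(Suc i := z))) field_differentiable at (s (Suc i))"
    and "deriv (\<lambda>z. transfer G (Suc (i + j)) (s(Suc i := z))) (s (Suc i)) =
         deriv (\<lambda>z. transfer Gred (Suc (i + j)) (s(Suc i := z))) (s (Suc i))"
proof -
  let ?z = "s (Suc i)"
  let ?P = "lft G t j" and ?Q = "rgt G s i"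
  let ?K = "sysK G" and ?R = "\<lambda>z. V ** matrix_inv (U ** sysK G z ** V) ** U"
  let ?f = "\<lambda>z. transfer G (Suc (i + j)) (s(Suc i := z))"
    and ?g = "\<lambda>z. transfer Gred (Suc (i + j)) (s(Suc i := z))"
  have P: "mat_analytic_at (\<lambda>z. ?P z) ?z"
    \<comment> \<open>The variable \<open>z\<close> enters only through the last factor,
      \<open>sysC G z\<close> or \<open>sysN G z\<close>; the rest is constant.\<close>
    by (cases j) (simp_all add: C N mat_analytic_at_mult)
  have Q: "mat_analytic_at (\<lambda>z. ?Q z) ?z"
    by (cases i) (use B N in \<open>simp_all add: mat_analytic_at_mult\<close>)
  have K': "mat_analytic_at ?K ?z"
    by (rule inverse_analytic_at_imp_analytic[OF K])
  have Ki: "mat_analytic_at (\<lambda>z. matrix_inv (?K z)) ?z" and evK: "\<forall>\<^sub>F z in nhds ?z. invertible (?K z)"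
    using K by (auto simp: inverse_analytic_at_def)
  have "inverse_analytic_at (\<lambda>z. U ** ?K z ** V) ?z"
    using s[of i] by (intro inverse_analytic_at_invertible mat_analytic_at_mult K' mat_analytic_at_const)
      (simp add: right_lift_def regular_at_def)
  then have Kh: "mat_analytic_at (\<lambda>z. matrix_inv (U ** ?K z ** V)) ?z"
    and evKh: "\<forall>\<^sub>F z in nhds ?z. invertible (U ** ?K z ** V)"
    by (auto simp: inverse_analytic_at_def)
  have E: "mat_analytic_at (\<lambda>z. E z) ?z"
    unfolding resolvent_error_def
    by (intro mat_analytic_at_diff mat_analytic_at_mult Ki Kh mat_analytic_at_const)

  \<comment> \<open>\<open>rgt\<close> reads only arguments up to \<open>i\<close> and
    \<open>lft\<close> only those from \<open>i + 2\<close> on, so varying slot \<open>Suc i\<close>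
    changes neither.\<close>
  have rgt: "rgt G (s(Suc i := z)) i = ?Q" for z
    by (intro ext rgt_cong) simp
  have lft: "lft G (\<lambda>l. (s(Suc i := z)) (i + j + 2 - l)) j = ?P" for z
    unfolding t_def by (intro ext lft_cong) auto
  have s': "right_lift (s(Suc i := z)) l" if "l < i" for z l
    using that s[of l] right_lift_cong[of l "s(Suc i := z)" s] by simp
  have t': "left_lift (\<lambda>l. (s(Suc i := z)) (i + j + 2 - l)) l" if "l < j" for z l
  proof -
    have "left_lift (\<lambda>l. (s(Suc i := z)) (i + j + 2 - l)) l \<longleftrightarrow> left_lift t l"
      using that by (intro left_lift_cong) (auto simp: t_def)
    then show ?thesis using that t[of l] by simp
  qed

  have f: "?f z = (?P z ** matrix_inv (?K z) ** ?Q z) $ 1 $ 1" for z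
    by (simp only: transfer_split lft rgt fun_upd_same)
  have g: "?g z = (?P z ** ?R z ** ?Q z) $ 1 $ 1" for z
    by (subst transfer_reduced) (use s' t' in \<open>simp_all only: lft rgt fun_upd_same\<close>)
  have fan: "mat_analytic_at (\<lambda>z. ?P z ** matrix_inv (?K z) ** ?Q z) ?z"
    by (intro mat_analytic_at_mult P Q Ki)
  have gan: "mat_analytic_at (\<lambda>z. ?P z ** ?R z ** ?Q z) ?z"
    by (intro mat_analytic_at_mult P Q Kh mat_analytic_at_const)
  show fd: "?f field_differentiable at ?z"
    unfolding f using fan by (auto simp: mat_analytic_at_def intro: analytic_on_imp_differentiable_at)
  show gd: "?g field_differentiable at ?z"
    unfolding g using gan by (auto simp: mat_analytic_at_def intro: analytic_on_imp_differentiable_at)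

  have "?P ?z ** E ?z = 0"
    using left_lift_annihilated[OF t[of j]] by (simp add: t_def)
  moreover have "E ?z ** ?Q ?z = 0"
    by (intro right_lift_annihilated s) simp
  ultimately have D: "((\<lambda>z. ((?P z ** E z) ** ?K z ** (E z ** ?Q z)) $ 1 $ 1)
      has_field_derivative 0) (at ?z)"
    by (intro deriv_double_zero mat_analytic_at_mult P Q E K')
  have diff: "?f z - ?g z = (?P z ** E z ** ?Q z) $ 1 $ 1" for z
    by (subst transfer_diff) (use s' t' in \<open>simp_all only: lft rgt fun_upd_same\<close>)
  \<comment> \<open>Idempotence requires both inverses, hence the restriction to a neighbourhood;
    the derivative sees nothing more.\<close>
  have "\<forall>\<^sub>F z in nhds ?z. ?f z - ?g z = ((?P z ** E z) ** ?K z ** (E z ** ?Q z)) $ 1 $ 1"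
    using evK evKh
  proof eventually_elim
    case (elim z)
    have "(?P z ** E z) ** ?K z ** (E z ** ?Q z) = ?P z ** (E z ** ?K z ** E z) ** ?Q z"
      by (simp add: matrix_mul_assoc)
    then show ?case
      by (simp only: diff resolvent_error_idem[OF elim])
  qed
  then have "deriv (\<lambda>z. ?f z - ?g z) ?z = deriv (\<lambda>z. ((?P z ** E z) ** ?K z ** (E z ** ?Q z)) $ 1 $ 1) ?z"
    by (intro deriv_cong_ev refl)
  also have "\<dots> = 0"
    by (rule DERIV_imp_deriv[OF D])
  finally show "deriv ?f ?z = deriv ?g ?z"
    using deriv_diff[OF fd gd] by simp
qed

end

section \<open>From the span conditions to the interpolation identities\<close>

theorem theorem6:
  fixes G :: "('n::finite) bilinear_system"
    and Ghat :: "('r::finite) bilinear_system"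
    and W V :: "complex^'r^'n"
    and k :: nat
    and \<sigma> :: "nat \<Rightarrow> complex"
    and v w :: "nat \<Rightarrow> complex^1^'n"
  assumes Ghat: "Ghat = reduced_system W V G"
    and k: "k \<ge> 1"
    and C_analytic: "\<And>i. i \<in> {1..k} \<Longrightarrow> mat_analytic_at (sysC G) (\<sigma> i)"
    and K_inv_analytic: "\<And>i. i \<in> {1..k} \<Longrightarrow> inverse_analytic_at (sysK G) (\<sigma> i)"
    and N_analytic: "\<And>i. i \<in> {1..k} \<Longrightarrow> mat_analytic_at (sysN G) (\<sigma> i)"
    and B_analytic: "\<And>i. i \<in> {1..k} \<Longrightarrow> mat_analytic_at (sysB G) (\<sigma> i)"
    and Khat_full_rank: "\<And>i. i \<in> {1..k} \<Longrightarrow> rank (sysK Ghat (\<sigma> i)) = CARD('r)"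
    and v_1: "v 1 = matrix_inv (sysK G (\<sigma> 1)) ** sysB G (\<sigma> 1)"
    and v_step: "\<And>j. j \<in> {2..k} \<Longrightarrow>
      v j = matrix_inv (sysK G (\<sigma> j)) ** sysN G (\<sigma> (j - 1)) ** v (j - 1)"
    and w_1: "w 1 = ctranspose (matrix_inv (sysK G (\<sigma> k))) ** ctranspose (sysC G (\<sigma> k))"
    and w_step: "\<And>j. j \<in> {2..k} \<Longrightarrow>
      w j = ctranspose (matrix_inv (sysK G (\<sigma> (k - j + 1))))
              ** ctranspose (sysN G (\<sigma> (k - j + 1))) ** w (j - 1)"
    and span_V: "vec.span (\<Union>j\<in>{1..k}. columns (v j)) \<subseteq> col_space V"
    and span_W: "vec.span (\<Union>j\<in>{1..k}. columns (w j)) \<subseteq> col_space W"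
  shows "(\<forall>j\<in>{1..<k}. transfer G j \<sigma> = transfer Ghat j \<sigma>)
    \<and> (\<forall>j\<in>{1..<k}. transfer G j (\<lambda>i. \<sigma> (k - j + i)) = transfer Ghat j (\<lambda>i. \<sigma> (k - j + i)))
    \<and> transfer G k \<sigma> = transfer Ghat k \<sigma>
    \<and> partials_exist k (transfer G k) \<sigma> \<and> partials_exist k (transfer Ghat k) \<sigma>
    \<and> complex_jacobian k (transfer G k) \<sigma> = complex_jacobian k (transfer Ghat k) \<sigma>
    \<and> (\<forall>q\<in>{1..k}. \<forall>\<eta>\<in>{1..k}.
         transfer G (q + \<eta>) (\<lambda>i. if i \<le> q then \<sigma> i else \<sigma> (k - \<eta> + (i - q)))
       = transfer Ghat (q + \<eta>) (\<lambda>i. if i \<le> q then \<sigma> i else \<sigma> (k - \<eta> + (i - q))))"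
proof -
  interpret projection G W V .
  \<comment> \<open>The points in reverse order, with \<open>\<tau> 1 = \<sigma> k\<close>, as
    \<open>lft\<close> expects.\<close>
  define \<tau> where "\<tau> = (\<lambda>l. \<sigma> (k + 1 - l))"
  have reg: "regular_at (\<sigma> i)" if "i \<in> {1..k}" for i
    using full_rank_invertible[OF Khat_full_rank[OF that]]
      inverse_analytic_at_imp_invertible[OF K_inv_analytic[OF that]]
    by (simp add: regular_at_def Ghat reduced_system_def)
  have v_eq: "v (Suc i) = matrix_inv (sysK G (\<sigma> (Suc i))) ** rgt G \<sigma> i (\<sigma> (Suc i))" if "i < k" for i
    using that
  proof (induction i)
    case 0
    then show ?case using v_1 by simp
  next
    case (Suc i)
    then show ?case using v_step[of "Suc (Suc i)"] by (simp add: matrix_mul_assoc)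
  qed
  have w_eq: "w (Suc j) = ctranspose (lft G \<tau> j (\<tau> (Suc j)) ** matrix_inv (sysK G (\<tau> (Suc j))))"
    if "j < k" for j
    using that
  proof (induction j)
    case 0
    then show ?case using w_1 by (simp add: ctranspose_mult \<tau>_def)
  next
    case (Suc j)
    \<comment> \<open>Truncated subtraction: this relies on
      \<open>Suc (Suc j) \<le> k\<close>.\<close>
    have "k - Suc (Suc j) + 1 = k + 1 - Suc (Suc j)"
      using Suc.prems by simp
    then show ?case
      using Suc w_step[of "Suc (Suc j)"] by (simp add: ctranspose_mult matrix_mul_assoc \<tau>_def)
  qed
  have right: "right_lift \<sigma> i" if "i < k" for i
  proof -
    have "columns (v (Suc i)) \<subseteq> (\<Union>j\<in>{1..k}. columns (v j))"
      using that by (intro UN_upper) simp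
    also have "\<dots> \<subseteq> col_space V"
      by (rule order_trans[OF vec.span_superset span_V])
    finally obtain c where "v (Suc i) = V ** c"
      by (rule columns_subset_col_space)
    then show ?thesis
      using that reg[of "Suc i"] v_eq[OF that] by (auto simp: right_lift_def)
  qed
  have left: "left_lift \<tau> j" if "j < k" for j
  proof -
    have "columns (w (Suc j)) \<subseteq> (\<Union>j\<in>{1..k}. columns (w j))"
      using that by (intro UN_upper) simp
    also have "\<dots> \<subseteq> col_space W"
      by (rule order_trans[OF vec.span_superset span_W])
    finally obtain c where c: "w (Suc j) = W ** c"
      by (rule columns_subset_col_space)
    have "lft G \<tau> j (\<tau> (Suc j)) ** matrix_inv (sysK G (\<tau> (Suc j))) = ctranspose (w (Suc j))"
      by (simp add: w_eq[OF that])
    then show ?thesis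
      using that reg[of "k - j"] by (auto simp: left_lift_def c ctranspose_mult \<tau>_def)
  qed

  \<comment> \<open>The range includes \<open>j = k\<close>, which also covers the value of the full
    transfer function.\<close>
  have first: "transfer G j \<sigma> = transfer Ghat j \<sigma>" if "j \<in> {1..k}" for j
  proof -
    have "right_lift \<sigma> l" if "l \<le> j - 1" for l
      using that \<open>j \<in> {1..k}\<close> by (intro right) auto
    then show ?thesis
      using that transfer_eq_right[of "j - 1" \<sigma> 0] by (simp add: Ghat)
  qed
  have second: "transfer G j (\<lambda>i. \<sigma> (k - j + i)) = transfer Ghat j (\<lambda>i. \<sigma> (k - j + i))"
    if j: "j \<in> {1..<k}" for j
  proof -
    have "left_lift (\<lambda>l. \<sigma> (k - j + (j - 1 + 2 - l))) l" if "l \<le> j - 1" for l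
    proof -
      have "left_lift (\<lambda>l. \<sigma> (k - j + (j - 1 + 2 - l))) l \<longleftrightarrow> left_lift \<tau> l"
        using that j by (intro left_lift_cong) (auto simp: \<tau>_def intro!: arg_cong[where f = \<sigma>])
      moreover have "l < k" using that j by auto
      ultimately show ?thesis using left by blast
    qed
    then show ?thesis
      using transfer_eq_left[of "j - 1" "\<lambda>i. \<sigma> (k - j + i)"] j by (simp add: Ghat)
  qed
  have mixed: "transfer G (q + \<eta>) (\<lambda>i. if i \<le> q then \<sigma> i else \<sigma> (k - \<eta> + (i - q)))
      = transfer Ghat (q + \<eta>) (\<lambda>i. if i \<le> q then \<sigma> i else \<sigma> (k - \<eta> + (i - q)))" (is "transfer G _ ?s = _")
    if q: "q \<in> {1..k}" and \<eta>: "\<eta> \<in> {1..k}" for q \<eta>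
  proof -
    have "right_lift ?s l" if "l \<le> q - 1" for l
    proof -
      have "right_lift ?s l \<longleftrightarrow> right_lift \<sigma> l"
        using that q by (intro right_lift_cong) auto
      moreover have "l < k" using that q by auto
      ultimately show ?thesis using right by blast
    qed
    moreover have "left_lift (\<lambda>l. ?s (q - 1 + \<eta> + 2 - l)) l" if "l < \<eta>" for l
    proof -
      \<comment> \<open>The last \<open>\<eta>\<close> arguments fall in the second branch of
        \<open>?s\<close>; read backwards, they are
        \<open>\<tau> 1, \<dots>, \<tau> \<eta>\<close>.\<close>
      have "left_lift (\<lambda>l. ?s (q - 1 + \<eta> + 2 - l)) l \<longleftrightarrow> left_lift \<tau> l"
        using that q \<eta> by (intro left_lift_cong) (auto simp: \<tau>_def intro!: arg_cong[where f = \<sigma>])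
      moreover have "l < k" using that \<eta> by auto
      ultimately show ?thesis using left by blast
    qed
    ultimately show ?thesis
      using transfer_eq_right[of "q - 1" ?s \<eta>] q by (simp add: Ghat)
  qed
  have partials:
      "(\<lambda>z. transfer G k (\<sigma>(i := z))) field_differentiable at (\<sigma> i)"
      "(\<lambda>z. transfer Ghat k (\<sigma>(i := z))) field_differentiable at (\<sigma> i)"
      "deriv (\<lambda>z. transfer G k (\<sigma>(i := z))) (\<sigma> i) = deriv (\<lambda>z. transfer Ghat k (\<sigma>(i := z))) (\<sigma> i)"
    if i: "i \<in> {1..k}" for i
  proof -
    \<comment> \<open>The cut is at slot \<open>i\<close>, with \<open>i - 1\<close> arguments
      before it and \<open>k - i\<close> after it.\<close>
    have eqs: "Suc (i - 1) = i" "Suc (i - 1 + (k - i)) = k"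
      and t: "(\<lambda>l. \<sigma> (i - 1 + (k - i) + 2 - l)) = \<tau>"
      using i by (auto simp: \<tau>_def)
    have right': "right_lift \<sigma> l" if "l \<le> i - 1" for l
      using that i by (intro right) auto
    have left': "left_lift \<tau> l" if "l \<le> k - i" for l
      using that i by (intro left) auto
    note D = partial_transfer[of "i - 1" \<sigma> "k - i", unfolded t eqs, OF right' left'
        C_analytic[OF i] N_analytic[OF i] B_analytic[OF i] K_inv_analytic[OF i], folded Ghat]
    show "(\<lambda>z. transfer G k (\<sigma>(i := z))) field_differentiable at (\<sigma> i)"
      "(\<lambda>z. transfer Ghat k (\<sigma>(i := z))) field_differentiable at (\<sigma> i)"
      "deriv (\<lambda>z. transfer G k (\<sigma>(i := z))) (\<sigma> i) = deriv (\<lambda>z. transfer Ghat k (\<sigma>(i := z))) (\<sigma> i)"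
      by (rule D; assumption)+
  qed
  show ?thesis
  proof (intro conjI ballI)
    show "transfer G k \<sigma> = transfer Ghat k \<sigma>"
      using first k by simp
    show "complex_jacobian k (transfer G k) \<sigma> = complex_jacobian k (transfer Ghat k) \<sigma>"
      unfolding complex_jacobian_def using partials(3) by auto
  qed (use first second mixed partials in \<open>auto simp: partials_exist_def\<close>)
qed

end
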